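(* Let $f:\mathbb{R}^n\to\mathbb{R}\cup\{\infty\}$ be a proper, lower semicontinuous, convex function with $\mathrm{dom}\,f$ unbounded. Then, for every $d\in\mathbb{R}^n$, $$\Phi_f(d)=\begin{cases}\sigma_{\partial f(\infty)}(d),&d\in(\partial^\infty f(\infty))^\circ,\\+\infty,&\text{otherwise,}\end{cases}$$ with the convention $\sigma_\emptyset\equiv-\infty$.
   Context: $\mathrm{dom}\,f=\{x\mid f(x)<\infty\}$; $f$ is proper if $\mathrm{dom}\,f\ne\emptyset$; $\mathrm{epi}\,f=\{(x,r)\in\mathbb{R}^n\times\mathbb{R}\mid r\ge f(x)\}$. $\sigma_C(d)=\sup_{u\in C}\langle u,d\rangle$ is the support function. For a cone $C$, $C^\circ=\{v\mid\langle v,x\rangle\le0\ \forall x\in C\}$. With $I=\{1,\dots,n\}$ selecting the $x$-coordinates in $\mathbb{R}^n\times\mathbb{R}$: $T(\infty_I;\mathrm{epi}\,f)$ is the set of $(w,\rho)$ such that for all sequences $(x_k,r_k)\in\mathrm{epi}\,f$ with $\|x_k\|\to\infty$ and all $t_k>0$ with $t_k\to0$ there exist $(w_k,\rho_k)\to(w,\rho)$ with $(x_k,r_k)+t_k(w_k,\rho_k)\in\mathrm{epi}\,f$ for all $k$. $N(\infty_I;\mathrm{epi}\,f)=\{(u,c)\mid\langle u,w\rangle+c\rho\le0\ \forall(w,\rho)\in T(\infty_I;\mathrm{epi}\,f)\}$. $\partial f(\infty)=\{u\mid(u,-1)\in N(\infty_I;\mathrm{epi}\,f)\}$, $\partial^\infty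 f(\infty)=\{u\mid(u,0)\in N(\infty_I;\mathrm{epi}\,f)\}$. $\Phi_f(d):=\inf\{\alpha\in\mathbb{R}\mid(d,\alpha)\in T(\infty_I;\mathrm{epi}\,f)\}\in[-\infty,+\infty]$, with $\inf\emptyset=+\infty$. *)

theory Defs
  imports "HOL-Analysis.Analysis"
begin

text \<open>
  A function into the reals extended by plus infinity is an \<^typ>\<open>ereal\<close>-valued function
  that never takes the value \<^term>\<open>-\<infinity> :: ereal\<close>; that side condition is stated as a
  hypothesis where needed and is not part of the definitions below.
\<close>

definition effective_domain :: "('a \<Rightarrow> ereal) \<Rightarrow> 'a set" where
  "effective_domain f = {x. f x < \<infinity>}"

definition proper_fun :: "('a \<Rightarrow> ereal) \<Rightarrow> bool" where
  "proper_fun f \<longleftrightarrow> effective_domain f \<noteq> {}"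

definition lower_semicontinuous :: "('a::topological_space \<Rightarrow> ereal) \<Rightarrow> bool" where
  "lower_semicontinuous f \<longleftrightarrow> (\<forall>x. f x \<le> Liminf (at x) f)"

text \<open>
  The weights are strictly between 0 and 1, so the convention \<open>0 * \<infinity> = 0\<close> is not used.
\<close>

definition convex_fun :: "('a::real_vector \<Rightarrow> ereal) \<Rightarrow> bool" where
  "convex_fun f \<longleftrightarrow>
     (\<forall>x y. \<forall>t::real. 0 < t \<and> t < 1 \<longrightarrow>
        f ((1 - t) *\<^sub>R x + t *\<^sub>R y) \<le> ereal (1 - t) * f x + ereal t * f y)"

definition epi :: "('a \<Rightarrow> ereal) \<Rightarrow> ('a \<times> real) set" where
  "epi f = {(x, r). f x \<le> ereal r}"

text \<open>Since \<open>Sup {} = -\<infinity>\<close> in \<^typ>\<open>ereal\<close>, the support function of the empty set is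
  constantly \<open>-\<infinity>\<close>.\<close>

definition support_function :: "'a::real_inner set \<Rightarrow> 'a \<Rightarrow> ereal" where
  "support_function C d = (SUP u\<in>C. ereal (inner u d))"

definition polar_cone :: "'a::real_inner set \<Rightarrow> 'a set" where
  "polar_cone C = {v. \<forall>x\<in>C. inner v x \<le> 0}"

text \<open>
  Tangent and normal cones at infinity, where only the first component of the points of
  \<open>C\<close> is required to diverge.
\<close>

definition tangent_cone_at_infinity :: "('a::real_normed_vector \<times> real) set \<Rightarrow> ('a \<times> real) set" where
  "tangent_cone_at_infinity C =
     {(w, \<rho>). \<forall>(x :: nat \<Rightarrow> 'a) (r :: nat \<Rightarrow> real) (t :: nat \<Rightarrow> real).
        (\<forall>k. (x k, r k) \<in> C) \<and> filterlim (\<lambda>k. norm (x k)) at_top sequentially \<and>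
        (\<forall>k. t k > 0) \<and> t \<longlonglongrightarrow> 0 \<longrightarrow>
        (\<exists>(w' :: nat \<Rightarrow> 'a) (\<rho>' :: nat \<Rightarrow> real).
           (\<lambda>k. (w' k, \<rho>' k)) \<longlonglongrightarrow> (w, \<rho>) \<and>
           (\<forall>k. (x k, r k) + t k *\<^sub>R (w' k, \<rho>' k) \<in> C))}"

definition normal_cone_at_infinity :: "('a::real_inner \<times> real) set \<Rightarrow> ('a \<times> real) set" where
  "normal_cone_at_infinity C =
     {(u, c). \<forall>(w, \<rho>) \<in> tangent_cone_at_infinity C. inner u w + c * \<rho> \<le> 0}"

definition subdiff_at_infinity :: "('a::real_inner \<Rightarrow> ereal) \<Rightarrow> 'a set" where
  "subdiff_at_infinity f = {u. (u, -1) \<in> normal_cone_at_infinity (epi f)}"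

definition singular_subdiff_at_infinity :: "('a::real_inner \<Rightarrow> ereal) \<Rightarrow> 'a set" where
  "singular_subdiff_at_infinity f = {u. (u, 0) \<in> normal_cone_at_infinity (epi f)}"

text \<open>The infimum is taken in \<^typ>\<open>ereal\<close>, where \<open>Inf {} = \<infinity>\<close>.\<close>

definition Phi :: "('a::real_inner \<Rightarrow> ereal) \<Rightarrow> 'a \<Rightarrow> ereal" where
  "Phi f d = (INF \<alpha> \<in> {\<alpha> :: real. (d, \<alpha>) \<in> tangent_cone_at_infinity (epi f)}. ereal \<alpha>)"

end

theory Submission
  imports Defs
begin

text \<open>
  The tangent cone at infinity \<open>T\<close> of an arbitrary set is a closed convex cone, so it is
  recovered from its polar \<open>N\<close>, the normal cone at infinity. As \<open>T\<close> of an epigraph contains the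
  vertical direction \<open>(0, 1)\<close>, every \<open>(u, c) \<in> N\<close> has \<open>c \<le> 0\<close>; after rescaling, \<open>(d, \<alpha>) \<in> T\<close>
  therefore amounts to \<open>\<langle>u, d\<rangle> \<le> \<alpha>\<close> for all subgradients \<open>u\<close> at infinity together with
  \<open>\<langle>u, d\<rangle> \<le> 0\<close> for all singular ones.
\<close>

section \<open>Preliminaries: a bipolar criterion and convergent selections\<close>

lemma mem_closed_convex_cone_if_bipolar:
  fixes z :: "'a::euclidean_space"
  assumes "closed T" "convex T" "cone T" "T \<noteq> {}"
    and bipolar: "\<And>y. (\<And>x. x \<in> T \<Longrightarrow> inner y x \<le> 0) \<Longrightarrow> inner y z \<le> 0"
  shows "z \<in> T"
proof (rule ccontr)
  assume "z \<notin> T"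
  \<comment> \<open>A hyperplane strictly separates \<open>z\<close> from \<open>T\<close>. Since
    \<open>T\<close> is a cone, \<open>inner a\<close> cannot be negative on it, so
    \<open>- a\<close> lies in the polar of \<open>T\<close> although
    \<open>inner (- a) z > - b > 0\<close>.\<close>
  then obtain a b where ab: "inner a z < b" "\<And>x. x \<in> T \<Longrightarrow> b < inner a x"
    using separating_hyperplane_closed_point[OF assms(2,1)] by metis
  have "0 \<in> T"
    using assms(3,4) by (simp add: cone_contains_0)
  then have "b < 0"
    using ab(2)[of 0] by simp
  have nonneg: "0 \<le> inner a x" if "x \<in> T" for x
  proof (rule ccontr)
    assume neg: "\<not> 0 \<le> inner a x"
    \<comment> \<open>Both \<open>b\<close> and \<open>inner a x\<close> are negative, so the factor
      is positive. It is chosen so that \<open>inner a\<close> takes exactly the value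
      \<open>b\<close> at the scaled point, against the strict inequality on
      \<open>T\<close>.\<close>
    then have "(b / inner a x) *\<^sub>R x \<in> T"
      using \<open>cone T\<close> that \<open>b < 0\<close> by (simp add: cone_def divide_nonpos_neg)
    then show False
      using ab(2) neg by fastforce
  qed
  have "inner (- a) z \<le> 0"
    using nonneg by (intro bipolar) simp
  then show False
    using ab(1) \<open>b < 0\<close> by simp
qed

text \<open>Turns the existence of a sequence of directions into the convergence of real numbers, so
  that the closedness proof below needs no diagonal sequence.\<close>

lemma selection_tendsto_iff_infdist:
  fixes S :: "nat \<Rightarrow> 'a::metric_space set"
  assumes ne: "\<And>k. S k \<noteq> {}"
  shows "(\<exists>v. v \<longlonglongrightarrow> z \<and> (\<forall>k. v k \<in> S k)) \<longleftrightarrow> (\<lambda>k. infdist z (S k)) \<longlonglongrightarrow> 0"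
    (is "?L \<longleftrightarrow> ?R")
proof
  assume ?L
  then obtain v where v: "v \<longlonglongrightarrow> z" "\<And>k. v k \<in> S k"
    by blast
  have "(\<lambda>k. dist z (v k)) \<longlonglongrightarrow> 0"
    using tendsto_dist[OF tendsto_const v(1), of z] by simp
  then show ?R
    using v(2) by (rule_tac tendsto_sandwich[of "\<lambda>_. 0"]) (auto simp: infdist_nonneg infdist_le)
next
  assume R: ?R
  \<comment> \<open>The infimum defining the distance may not be attained, so near-minimisers with
    slack \<open>1 / (k + 1)\<close> are selected; the slack tends to 0.\<close>
  have "\<exists>x\<in>S k. dist z x < infdist z (S k) + inverse (real (Suc k))" for k
  proof -
    have "(INF x\<in>S k. dist z x) < infdist z (S k) + inverse (real (Suc k))"
      using ne by (simp add: infdist_notempty)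
    then show ?thesis
      using ne by (subst (asm) cINF_less_iff) auto
  qed
  then obtain v where v: "\<And>k. v k \<in> S k"
      "\<And>k. dist z (v k) < infdist z (S k) + inverse (real (Suc k))"
    by metis
  have "(\<lambda>k. infdist z (S k) + inverse (real (Suc k))) \<longlonglongrightarrow> 0"
    using tendsto_add[OF R LIMSEQ_inverse_real_of_nat] by simp
  then have "(\<lambda>k. dist (v k) z) \<longlonglongrightarrow> 0"
    using v(2) by (rule_tac tendsto_sandwich[of "\<lambda>_. 0"])
      (auto simp: dist_commute intro!: always_eventually less_imp_le)
  then show ?L
    using v(1) tendsto_dist_iff by blast
qed

text \<open>Merges the two coordinate sequences into one sequence in the product space, where vector
  arithmetic and limits apply directly.\<close>

lemma mem_tangent_cone_at_infinity_iff:
  "z \<in> tangent_cone_at_infinity C \<longleftrightarrow>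
    (\<forall>p t. (\<forall>k. p k \<in> C) \<longrightarrow> filterlim (\<lambda>k. norm (fst (p k))) at_top sequentially \<longrightarrow>
       (\<forall>k. t k > 0) \<longrightarrow> t \<longlonglongrightarrow> 0 \<longrightarrow>
       (\<exists>v. v \<longlonglongrightarrow> z \<and> (\<forall>k. p k + t k *\<^sub>R v k \<in> C)))"
  (is "_ \<longleftrightarrow> ?R")
proof
  assume z: "z \<in> tangent_cone_at_infinity C"
  obtain w \<rho> where zw: "z = (w, \<rho>)"
    by fastforce
  show ?R
  proof (intro allI impI)
    fix p :: "nat \<Rightarrow> 'a \<times> real" and t :: "nat \<Rightarrow> real"
    assume "\<forall>k. p k \<in> C" "filterlim (\<lambda>k. norm (fst (p k))) at_top sequentially"
      "\<forall>k. t k > 0" "t \<longlonglongrightarrow> 0"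
    then have "\<exists>w' \<rho>'. (\<lambda>k. (w' k, \<rho>' k)) \<longlonglongrightarrow> (w, \<rho>) \<and>
        (\<forall>k. (fst (p k), snd (p k)) + t k *\<^sub>R (w' k, \<rho>' k) \<in> C)"
      by (intro z[unfolded zw tangent_cone_at_infinity_def mem_Collect_eq case_prod_conv,
            rule_format] conjI) (simp_all only: prod.collapse simp_thms)
    then obtain w' \<rho>' where "(\<lambda>k. (w' k, \<rho>' k)) \<longlonglongrightarrow> z"
        "\<forall>k. p k + t k *\<^sub>R (w' k, \<rho>' k) \<in> C"
      unfolding zw prod.collapse by blast
    then show "\<exists>v. v \<longlonglongrightarrow> z \<and> (\<forall>k. p k + t k *\<^sub>R v k \<in> C)"
      by (intro exI[of _ "\<lambda>k. (w' k, \<rho>' k)"] conjI)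
  qed
next
  assume R: ?R
  obtain w \<rho> where zw: "z = (w, \<rho>)"
    by fastforce
  show "z \<in> tangent_cone_at_infinity C"
    unfolding zw tangent_cone_at_infinity_def mem_Collect_eq case_prod_conv
  proof (intro allI impI, elim conjE)
    fix x :: "nat \<Rightarrow> 'a" and r t :: "nat \<Rightarrow> real"
    assume "\<forall>k. (x k, r k) \<in> C" "filterlim (\<lambda>k. norm (x k)) at_top sequentially"
      "\<forall>k. t k > 0" "t \<longlonglongrightarrow> 0"
    then obtain v where "v \<longlonglongrightarrow> z" "\<forall>k. (x k, r k) + t k *\<^sub>R v k \<in> C"
      using R[rule_format, of "\<lambda>k. (x k, r k)" t] by auto
    then show "\<exists>w' \<rho>'. (\<lambda>k. (w' k, \<rho>' k)) \<longlonglongrightarrow> (w, \<rho>) \<and>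
        (\<forall>k. (x k, r k) + t k *\<^sub>R (w' k, \<rho>' k) \<in> C)"
      unfolding zw by (intro exI[of _ "fst \<circ> v"] exI[of _ "snd \<circ> v"]) simp
  qed
qed

section \<open>The tangent cone at infinity is a closed convex cone\<close>

lemma zero_mem_tangent_cone_at_infinity: "0 \<in> tangent_cone_at_infinity C"
  unfolding mem_tangent_cone_at_infinity_iff by (auto intro!: exI[of _ "\<lambda>_. 0"])

text \<open>For fixed base points and step sizes, let \<open>S k\<close> be the set of admissible
  directions at index \<open>k\<close>. The distance to \<open>S k\<close> is 1-Lipschitz uniformly
  in \<open>k\<close>, so its convergence to 0 passes from the points \<open>y n\<close> to their
  limit.\<close>

lemma closed_tangent_cone_at_infinity: "closed (tangent_cone_at_infinity C)"
proof (rule closed_sequential_limits[THEN iffD2], intro allI impI, elim conjE)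
  fix y :: "nat \<Rightarrow> 'a \<times> real" and z
  assume y: "\<forall>n. y n \<in> tangent_cone_at_infinity C" and lim: "y \<longlonglongrightarrow> z"
  show "z \<in> tangent_cone_at_infinity C"
    unfolding mem_tangent_cone_at_infinity_iff
  proof (intro allI impI)
    fix p :: "nat \<Rightarrow> 'a \<times> real" and t :: "nat \<Rightarrow> real"
    assume h: "\<forall>k. p k \<in> C" "filterlim (\<lambda>k. norm (fst (p k))) at_top sequentially"
      "\<forall>k. t k > 0" "t \<longlonglongrightarrow> 0"
    define S where "S k = {v. p k + t k *\<^sub>R v \<in> C}" for k
    \<comment> \<open>Nonemptiness matters because \<open>infdist\<close> to the empty set is 0 by
      convention.\<close>
    have "0 \<in> S k" for k
      using h(1) by (simp add: S_def)
    then have ne: "S k \<noteq> {}" for k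
      by blast
    have infdist_y: "(\<lambda>k. infdist (y n) (S k)) \<longlonglongrightarrow> 0" for n
      using y h unfolding selection_tendsto_iff_infdist[OF ne, symmetric]
      by (auto simp: mem_tangent_cone_at_infinity_iff S_def)
    have "(\<lambda>k. infdist z (S k)) \<longlonglongrightarrow> 0"
    proof (rule LIMSEQ_I)
      fix e :: real
      assume "0 < e"
      then obtain n where n: "dist (y n) z < e / 2"
        using lim by (metis half_gt_zero lim_sequentially order_refl)
      have "\<forall>\<^sub>F k in sequentially. infdist (y n) (S k) < e / 2"
        using \<open>0 < e\<close> by (intro order_tendstoD(2)[OF infdist_y]) simp
      then obtain N where N: "\<And>k. k \<ge> N \<Longrightarrow> infdist (y n) (S k) < e / 2"
        by (auto simp: eventually_sequentially)
      have "norm (infdist z (S k) - 0) < e" if "k \<ge> N" for k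
        using infdist_triangle[of z "S k" "y n"] N[OF that] n
        by (simp add: infdist_nonneg dist_commute)
      then show "\<exists>N. \<forall>k\<ge>N. norm (infdist z (S k) - 0) < e"
        by blast
    qed
    then show "\<exists>v. v \<longlonglongrightarrow> z \<and> (\<forall>k. p k + t k *\<^sub>R v k \<in> C)"
      unfolding selection_tendsto_iff_infdist[OF ne, symmetric] by (simp add: S_def)
  qed
qed

text \<open>A move of size \<open>t k\<close> along the first direction keeps the base points divergent, so the
  second direction is available at the moved points.\<close>

lemma tangent_cone_at_infinity_add:
  assumes "y \<in> tangent_cone_at_infinity C" "z \<in> tangent_cone_at_infinity C"
  shows "y + z \<in> tangent_cone_at_infinity C"
  unfolding mem_tangent_cone_at_infinity_iff
proof (intro allI impI)
  fix p :: "nat \<Rightarrow> 'a \<times> real" and t :: "nat \<Rightarrow> real"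
  assume h: "\<forall>k. p k \<in> C" "filterlim (\<lambda>k. norm (fst (p k))) at_top sequentially"
    "\<forall>k. t k > 0" "t \<longlonglongrightarrow> 0"
  then obtain v where v: "v \<longlonglongrightarrow> y" "\<forall>k. p k + t k *\<^sub>R v k \<in> C"
    using assms(1) unfolding mem_tangent_cone_at_infinity_iff by blast
  define q where "q k = p k + t k *\<^sub>R v k" for k
  have "(\<lambda>k. norm (fst (t k *\<^sub>R v k))) \<longlonglongrightarrow> norm (fst (0 *\<^sub>R y))"
    by (intro tendsto_norm tendsto_fst tendsto_scaleR h v)
  then have "filterlim (\<lambda>k. - norm (fst (t k *\<^sub>R v k)) + norm (fst (p k))) at_top sequentially"
    by (rule filterlim_tendsto_add_at_top[OF tendsto_minus h(2)])
  then have "filterlim (\<lambda>k. norm (fst (q k))) at_top sequentially"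
  proof (rule filterlim_at_top_mono, intro always_eventually allI)
    show "- norm (fst (t k *\<^sub>R v k)) + norm (fst (p k)) \<le> norm (fst (q k))" for k
      using norm_diff_ineq[of "fst (p k)" "fst (t k *\<^sub>R v k)"] by (simp add: q_def)
  qed
  moreover have "\<forall>k. q k \<in> C"
    using v(2) by (simp add: q_def)
  ultimately obtain v' where v': "v' \<longlonglongrightarrow> z" "\<forall>k. q k + t k *\<^sub>R v' k \<in> C"
    using assms(2)[unfolded mem_tangent_cone_at_infinity_iff, rule_format, of q t] h(3,4) by auto
  show "\<exists>v. v \<longlonglongrightarrow> y + z \<and> (\<forall>k. p k + t k *\<^sub>R v k \<in> C)"
    \<comment> \<open>The two successive moves have the same step size, so they combine into one
      move along \<open>v k + v' k\<close>.\<close>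
    using v' by (intro exI[of _ "\<lambda>k. v k + v' k"] conjI tendsto_add v(1))
      (simp_all add: q_def scaleR_add_right add.assoc)
qed

text \<open>A positive factor is absorbed into the step sizes: \<open>t k * c\<close> is again a
  positive null sequence, and moving by \<open>t k * c\<close> along \<open>v k\<close> is moving by
  \<open>t k\<close> along \<open>c *\<^sub>R v k\<close>.\<close>

lemma tangent_cone_at_infinity_scale:
  assumes "z \<in> tangent_cone_at_infinity C" "0 \<le> c"
  shows "c *\<^sub>R z \<in> tangent_cone_at_infinity C"
proof (cases "c = 0")
  case True
  then show ?thesis
    by (simp add: zero_mem_tangent_cone_at_infinity)
next
  case False
  with assms(2) have c: "0 < c"
    by simp
  show ?thesis
    unfolding mem_tangent_cone_at_infinity_iff
  proof (intro allI impI)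
    fix p :: "nat \<Rightarrow> 'a \<times> real" and t :: "nat \<Rightarrow> real"
    assume h: "\<forall>k. p k \<in> C" "filterlim (\<lambda>k. norm (fst (p k))) at_top sequentially"
      "\<forall>k. t k > 0" "t \<longlonglongrightarrow> 0"
    have "(\<lambda>k. t k * c) \<longlonglongrightarrow> 0" "\<forall>k. t k * c > 0"
      using c h(3) tendsto_mult_left_zero[OF h(4)] by auto
    then obtain v where "v \<longlonglongrightarrow> z" "\<forall>k. p k + (t k * c) *\<^sub>R v k \<in> C"
      using assms(1)[unfolded mem_tangent_cone_at_infinity_iff, rule_format, of p "\<lambda>k. t k * c"]
        h(1,2) by auto
    then show "\<exists>v. v \<longlonglongrightarrow> c *\<^sub>R z \<and> (\<forall>k. p k + t k *\<^sub>R v k \<in> C)"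
      by (intro exI[of _ "\<lambda>k. c *\<^sub>R v k"]) (auto intro: tendsto_scaleR)
  qed
qed

lemma cone_tangent_cone_at_infinity: "cone (tangent_cone_at_infinity C)"
  by (simp add: cone_def tangent_cone_at_infinity_scale)

lemma convex_tangent_cone_at_infinity: "convex (tangent_cone_at_infinity C)"
  by (auto simp: convex_def intro!: tangent_cone_at_infinity_add tangent_cone_at_infinity_scale)

section \<open>Polarity between the tangent and normal cones at infinity\<close>

lemma mem_normal_cone_at_infinity_iff:
  "y \<in> normal_cone_at_infinity C \<longleftrightarrow> (\<forall>z\<in>tangent_cone_at_infinity C. inner y z \<le> 0)"
  by (cases y) (auto simp: normal_cone_at_infinity_def)

lemma mem_tangent_cone_at_infinity_iff_normal:
  fixes z :: "'a::euclidean_space \<times> real"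
  shows "z \<in> tangent_cone_at_infinity C \<longleftrightarrow> (\<forall>y\<in>normal_cone_at_infinity C. inner y z \<le> 0)"
    (is "_ \<longleftrightarrow> ?R")
proof
  assume ?R
  then show "z \<in> tangent_cone_at_infinity C"
    using zero_mem_tangent_cone_at_infinity[of C]
    by (intro mem_closed_convex_cone_if_bipolar closed_tangent_cone_at_infinity
        convex_tangent_cone_at_infinity cone_tangent_cone_at_infinity)
      (auto simp: mem_normal_cone_at_infinity_iff)
qed (auto simp: mem_normal_cone_at_infinity_iff)

lemma normal_cone_at_infinity_scale:
  assumes "y \<in> normal_cone_at_infinity C" "0 \<le> c"
  shows "c *\<^sub>R y \<in> normal_cone_at_infinity C"
  using assms by (auto simp: mem_normal_cone_at_infinity_iff mult_nonneg_nonpos)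

section \<open>Epigraphs and the formula for \<open>Phi\<close>\<close>

lemma vertical_mem_tangent_cone_at_infinity_epi: "(0, 1) \<in> tangent_cone_at_infinity (epi f)"
  unfolding mem_tangent_cone_at_infinity_iff
proof (intro allI impI)
  fix p :: "nat \<Rightarrow> 'a \<times> real" and t :: "nat \<Rightarrow> real"
  assume h: "\<forall>k. p k \<in> epi f" "\<forall>k. t k > 0"
  have "p k + t k *\<^sub>R (0, 1) \<in> epi f" for k
  proof (cases "p k")
    case (Pair x r)
    then have "f x \<le> ereal r"
      using h(1) by (auto simp: epi_def dest: spec[of _ k])
    also have "\<dots> \<le> ereal (r + t k)"
      using h(2) by (simp add: less_imp_le)
    finally show ?thesis
      using Pair by (simp add: epi_def)
  qed
  then show "\<exists>v. v \<longlonglongrightarrow> (0, 1) \<and> (\<forall>k. p k + t k *\<^sub>R v k \<in> epi f)"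
    by (intro exI[of _ "\<lambda>_. (0, 1)"]) simp
qed

lemma mem_tangent_cone_at_infinity_epi_iff:
  fixes f :: "'a::euclidean_space \<Rightarrow> ereal"
  shows "(d, \<alpha>) \<in> tangent_cone_at_infinity (epi f) \<longleftrightarrow>
    d \<in> polar_cone (singular_subdiff_at_infinity f) \<and>
    support_function (subdiff_at_infinity f) d \<le> ereal \<alpha>"
    (is "?L \<longleftrightarrow> ?P \<and> ?S")
proof
  assume ?L
  then have N: "inner u d + c * \<alpha> \<le> 0" if "(u, c) \<in> normal_cone_at_infinity (epi f)" for u c
    using that by (auto simp: mem_tangent_cone_at_infinity_iff_normal)
  have ?P
    using N[of _ 0] by (auto simp: polar_cone_def singular_subdiff_at_infinity_def inner_commute)
  moreover have ?S
    using N[of _ "-1"] by (auto simp: support_function_def subdiff_at_infinity_def intro!: SUP_least)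
  ultimately show "?P \<and> ?S" ..
next
  assume PS: "?P \<and> ?S"
  show ?L
    unfolding mem_tangent_cone_at_infinity_iff_normal
  proof
    fix y
    assume y: "y \<in> normal_cone_at_infinity (epi f)"
    obtain u c where yu: "y = (u, c)"
      by fastforce
    have "inner y (0, 1) \<le> 0"
      using y vertical_mem_tangent_cone_at_infinity_epi
      unfolding mem_normal_cone_at_infinity_iff by blast
    then have "c \<le> 0"
      by (simp add: yu)
    show "inner y (d, \<alpha>) \<le> 0"
    proof (cases "c = 0")
      case True
      then have "u \<in> singular_subdiff_at_infinity f"
        using y by (simp add: yu singular_subdiff_at_infinity_def)
      then show ?thesis
        using PS True by (auto simp: yu polar_cone_def inner_commute)
    next
      case False
      with \<open>c \<le> 0\<close> have "c < 0"
        by simp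
      \<comment> \<open>The positive factor \<open>inverse (- c)\<close> makes the last coordinate
        -1, so the first one becomes a subgradient at infinity.\<close>
      have "inverse (- c) *\<^sub>R y \<in> normal_cone_at_infinity (epi f)"
        using y \<open>c < 0\<close> by (intro normal_cone_at_infinity_scale) auto
      then have "inverse (- c) *\<^sub>R u \<in> subdiff_at_infinity f"
        using \<open>c < 0\<close> by (simp add: yu subdiff_at_infinity_def)
      then have "ereal (inner (inverse (- c) *\<^sub>R u) d) \<le> ereal \<alpha>"
        using PS unfolding support_function_def by (meson SUP_upper order_trans)
      then show ?thesis
        using \<open>c < 0\<close> by (simp add: yu field_simps)
    qed
  qed
qed

text \<open>An extended real is determined by its real upper bounds. This covers both infinite
  values: for \<open>s = \<infinity>\<close> there are no such bounds and the infimum is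
  \<infinity>, for \<open>s = -\<infinity>\<close> all reals qualify.\<close>

lemma Inf_ereal_above: "(INF \<alpha>\<in>{\<alpha>. s \<le> ereal \<alpha>}. ereal \<alpha>) = s"
proof (rule antisym)
  show "(INF \<alpha>\<in>{\<alpha>. s \<le> ereal \<alpha>}. ereal \<alpha>) \<le> s"
  proof (rule ereal_le_real)
    show "(INF \<alpha>\<in>{\<alpha>. s \<le> ereal \<alpha>}. ereal \<alpha>) \<le> ereal x" if "s \<le> ereal x" for x
      using that by (intro INF_lower) simp
  qed
qed (auto intro: INF_greatest)

theorem proposition4p28:
  fixes f :: "real ^ 'n \<Rightarrow> ereal" and d :: "real ^ 'n"
  assumes "\<forall>x. f x \<noteq> -\<infinity>"
    and "proper_fun f"
    and "lower_semicontinuous f"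
    and "convex_fun f"
    and "\<not> bounded (effective_domain f)"
  shows "Phi f d =
    (if d \<in> polar_cone (singular_subdiff_at_infinity f)
     then support_function (subdiff_at_infinity f) d
     else \<infinity>)"
  \<comment> \<open>Inside the polar cone the infimum runs over the real upper bounds of the support
    function at \<open>d\<close>; outside it runs over the empty set, which gives the top element
    \<infinity>.\<close>
  by (simp add: Phi_def mem_tangent_cone_at_infinity_epi_iff Inf_ereal_above top_ereal_def)

end
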